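(* Let $a,b$ be fixed positive coprime integers and $g$ a positive integer. Then $$\mu_j(g)=\sum_{k=0}^{j}(-1)^kE_kH_{g-k}\qquad\text{for }0\le j<g.$$
   Context: Lattice paths take steps in $\{(1,0),(0,1)\}$. The points of a path are the lattice points it visits, including its startpoint and endpoint. A flaw of a path is a point of the path lying strictly above the line segment joining its startpoint to its endpoint. $N_k(g)$ is the set of paths from $(0,0)$ to $(ga,gb)$ with exactly $k$ flaws, and $\mu_j(g):=|N_{j(a+b)}(g)|$ for $0\le j<g$ (so that $|N_k(g)|=\mu_j(g)$ whenever $j(a+b)\le k<(j+1)(a+b)$). For $i>0$ let $c_i:=\frac{1}{i(a+b)}\binom{i(a+b)}{ia}$. For a partition $\lambda=\langle 1^{m_1}2^{m_2}\cdots\rangle$ of a positive integer $n$ (having $m_i$ parts equal to $i$), let $l(\lambda)=\sum_i m_i$ and $c_\lambda:=\prod_{i\ge1}c_i^{m_i}/m_i!$. For $n\ge1$ define $H_n:=\sum_{\lambda\vdash n}c_\lambda$ and $E_n:=\sum_{\lambda\vdash n}(-1)^{n-l(\lambda)}c_\lambda$, and set $E_0:=1$. *)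

theory Defs
  imports "HOL-Analysis.Analysis" "HOL-Library.Multiset"
begin

text \<open>A lattice path is given by the nonempty list of the points it visits, in order.\<close>

definition lattice_path :: "(int \<times> int) list \<Rightarrow> bool" where
  "lattice_path p \<longleftrightarrow> p \<noteq> [] \<and> successively (\<lambda>u v. v - u \<in> {(1, 0), (0, 1)}) p"

definition real_point :: "int \<times> int \<Rightarrow> real \<times> real" where
  "real_point u = (real_of_int (fst u), real_of_int (snd u))"

text \<open>A point lies strictly above a segment if the segment contains a point with the same
  abscissa and a strictly smaller ordinate. This is only meant for non-vertical segments.\<close>

definition strictly_above :: "real \<times> real \<Rightarrow> (real \<times> real) set \<Rightarrow> bool" where
  "strictly_above z S \<longleftrightarrow> (\<exists>y. (fst z, y) \<in> S \<and> y < snd z)"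

definition flaws :: "(int \<times> int) list \<Rightarrow> (int \<times> int) set" where
  "flaws p = {u \<in> set p. strictly_above (real_point u)
                           (closed_segment (real_point (hd p)) (real_point (last p)))}"

definition paths_with_flaws :: "nat \<Rightarrow> nat \<Rightarrow> nat \<Rightarrow> nat \<Rightarrow> (int \<times> int) list set" where
  "paths_with_flaws a b k g =
     {p. lattice_path p \<and> hd p = (0, 0) \<and> last p = (int (g * a), int (g * b)) \<and>
         card (flaws p) = k}"

definition mu :: "nat \<Rightarrow> nat \<Rightarrow> nat \<Rightarrow> nat \<Rightarrow> nat" where
  "mu a b j g = card (paths_with_flaws a b (j * (a + b)) g)"

definition c :: "nat \<Rightarrow> nat \<Rightarrow> nat \<Rightarrow> real" where
  "c a b i = 1 / real (i * (a + b)) * real ((i * (a + b)) choose (i * a))"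

text \<open>A partition of \<open>n\<close> is the multiset \<open>P\<close> of its parts: the multiplicity \<open>m\<^sub>i\<close> is \<open>count P i\<close>
  and the length \<open>l(P)\<close> is \<open>size P\<close>.\<close>

definition partitions :: "nat \<Rightarrow> nat multiset set" where
  "partitions n = {P. 0 \<notin># P \<and> sum_mset P = n}"

lemma size_le_partition:
  assumes "P \<in> partitions n"
  shows "size P \<le> n"
proof -
  have "0 \<notin># P \<Longrightarrow> size P \<le> sum_mset P" for P :: "nat multiset"
    by (induction P) auto
  with assms show ?thesis by (auto simp: partitions_def)
qed

lemma finite_partitions: "finite (partitions n)"
proof (rule finite_subset)
  show "partitions n \<subseteq> mset ` {xs. set xs \<subseteq> {..n} \<and> length xs \<le> n}"
  proof
    fix P assume P: "P \<in> partitions n"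
    obtain xs where xs: "mset xs = P" using ex_mset by blast
    have "x \<le> n" if "x \<in># P" for x
      using P that by (auto simp: partitions_def dest!: multi_member_split)
    moreover have "length xs \<le> n"
      using size_le_partition[OF P] xs by auto
    ultimately show "P \<in> mset ` {xs. set xs \<subseteq> {..n} \<and> length xs \<le> n}"
      using xs by (intro image_eqI[of _ _ xs]) auto
  qed
  show "finite (mset ` {xs. set xs \<subseteq> {..n} \<and> length xs \<le> n})"
    by (intro finite_imageI finite_lists_length_le) simp
qed

text \<open>The factors with \<open>m\<^sub>i = 0\<close> are all \<open>1\<close>, so the product over \<open>i \<ge> 1\<close> reduces to the
  indices that occur as parts.\<close>

definition c_part :: "nat \<Rightarrow> nat \<Rightarrow> nat multiset \<Rightarrow> real" where
  "c_part a b P = (\<Prod>i\<in>set_mset P. c a b i ^ count P i / fact (count P i))"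

definition H :: "nat \<Rightarrow> nat \<Rightarrow> nat \<Rightarrow> real" where
  "H a b n = (\<Sum>P\<in>partitions n. c_part a b P)"

definition E :: "nat \<Rightarrow> nat \<Rightarrow> nat \<Rightarrow> real" where
  "E a b n = (if n = 0 then 1 else \<Sum>P\<in>partitions n. (-1) ^ (n - size P) * c_part a b P)"

end

theory Submission
  imports Defs "HOL-Computational_Algebra.Formal_Power_Series"
begin

text \<open>Encode a path by its steps \<open>a\<close> (up) and \<open>-b\<close> (right), so that a flaw is a positive partial sum.
  By the Sparre Andersen rearrangement (put the steps that end in a flaw, in reverse order, before the
  others), paths with \<open>k\<close> flaws correspond to paths whose first maximum is at time \<open>k\<close>. Cutting
  such a path at its first maximum and exchanging the two pieces gives a path without flaws whose
  last excursion from the diagonal has more than \<open>k\<close> steps. With \<open>z\<^sub>i\<close> and \<open>p\<^sub>i\<close> the numbers of paths of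
  size \<open>i\<close> without flaws, respectively strictly below the diagonal between their endpoints, this means
  \<open>|N\<^sub>k(g)| = (\<Sum>i | i (a + b) > k. p\<^sub>i z\<^bsub>g-i\<^esub>)\<close>.
  Let \<open>Z\<close>, \<open>P\<close> and \<open>C\<close> be the generating functions of \<open>z\<^sub>i\<close>, \<open>p\<^sub>i\<close> and \<open>c\<^sub>i\<close>. The case \<open>k = 0\<close> gives
  \<open>Z (1 - P) = 1\<close>, and summing over all \<open>k\<close> gives \<open>C' = P' Z = Z' / Z\<close>. Hence \<open>Z = exp C\<close> and
  \<open>1 - P = exp (-C)\<close>, whose coefficients are \<open>H\<^sub>n\<close> and \<open>(-1)\<^sup>n E\<^sub>n\<close>.\<close>

section \<open>The Sparre Andersen rearrangement\<close>

text \<open>Suffixes rather than prefixes, so that structural recursion on the list produces the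
  sums. The empty suffix is left out: for a path listed from its last step, its sum 0 belongs to the
  startpoint.\<close>

fun all_suffix_sums :: "('a::monoid_add \<Rightarrow> bool) \<Rightarrow> 'a list \<Rightarrow> bool" where
  "all_suffix_sums Q [] \<longleftrightarrow> True"
| "all_suffix_sums Q (x # xs) \<longleftrightarrow> Q (sum_list (x # xs)) \<and> all_suffix_sums Q xs"

text \<open>For a word of steps this is the number of flaws.\<close>

fun positive_suffix_sums :: "'a::{monoid_add,ord} list \<Rightarrow> nat" where
  "positive_suffix_sums [] = 0"
| "positive_suffix_sums (x # xs) =
     (if sum_list (x # xs) > 0 then 1 else 0) + positive_suffix_sums xs"

text \<open>Separates the steps that end in a flaw from the others. Both lists keep the original
  order; the reversal comes later, with \<open>rev u @ v\<close>.\<close>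

fun rearr :: "'a::{monoid_add,ord} list \<Rightarrow> 'a list \<times> 'a list" where
  "rearr [] = ([], [])"
| "rearr (x # xs) =
     (if sum_list (x # xs) > 0 then (x # fst (rearr xs), snd (rearr xs))
      else (fst (rearr xs), x # snd (rearr xs)))"

lemma all_suffix_sums_iff:
  "all_suffix_sums Q xs \<longleftrightarrow> (\<forall>i<length xs. Q (sum_list (drop i xs)))"
  by (induction xs) (simp_all add: All_less_Suc2)

lemma all_suffix_sums_append:
  "all_suffix_sums Q (xs @ ys) \<longleftrightarrow>
     all_suffix_sums (\<lambda>s. Q (s + sum_list ys)) xs \<and> all_suffix_sums Q ys"
  by (induction xs) (auto simp: add.assoc)

lemma positive_suffix_sums_le: "positive_suffix_sums xs \<le> length xs"
  by (induction xs) auto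

lemma all_suffix_sums_sum_list:
  assumes "all_suffix_sums Q xs" and "Q 0 \<or> xs \<noteq> []"
  shows "Q (sum_list xs)"
  using assms by (cases xs) auto

lemma length_fst_rearr: "length (fst (rearr xs)) = positive_suffix_sums xs"
  by (induction xs) auto

lemma mset_rearr: "mset (fst (rearr xs)) + mset (snd (rearr xs)) = mset xs"
  by (induction xs) auto

lemma sum_list_rearr:
  fixes xs :: "'a::linordered_ab_group_add list"
  shows "sum_list (fst (rearr xs)) + sum_list (snd (rearr xs)) = sum_list xs"
  by (metis mset_rearr sum_mset.union sum_mset_sum_list)

text \<open>By induction \<open>sum_list u \<ge> 0\<close> and \<open>sum_list v \<le> 0\<close> for
  the two parts of the tail. A positive total thus stays positive without \<open>v\<close>, and a
  nonpositive total stays nonpositive without \<open>u\<close>, so the list that receives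
  \<open>x\<close> keeps its sign condition.\<close>

lemma suffix_sums_rearr:
  fixes xs :: "'a::linordered_ab_group_add list"
  shows "all_suffix_sums (\<lambda>s. s > 0) (fst (rearr xs)) \<and>
         all_suffix_sums (\<lambda>s. s \<le> 0) (snd (rearr xs))"
proof (induction xs)
  case (Cons x xs)
  let ?u = "fst (rearr xs)" and ?v = "snd (rearr xs)"
  have u: "sum_list ?u \<ge> 0"
    using Cons all_suffix_sums_sum_list[of "\<lambda>s. s > 0" ?u]
    by (cases "?u = []") auto
  have v: "sum_list ?v \<le> 0"
    using Cons all_suffix_sums_sum_list[of "\<lambda>s. s \<le> 0" ?v] by auto
  have s: "sum_list (x # xs) = x + sum_list ?u + sum_list ?v"
    using sum_list_rearr[of xs] by (simp add: add.assoc)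
  show ?case
  proof (cases "sum_list (x # xs) > 0")
    case True
    then have "x + sum_list ?u > 0"
      using v unfolding s by (metis add_nonpos_nonpos not_less)
    then show ?thesis using Cons True by simp
  next
    case False
    have "x + sum_list ?v \<le> x + sum_list ?u + sum_list ?v"
      using u by simp
    then have "x + sum_list ?v \<le> 0"
      using False unfolding s by (meson not_less order_trans)
    then show ?thesis using Cons False by simp
  qed
qed simp

text \<open>The image determines the total sum, and the sign of that sum tells which of the two
  lists received the first step.\<close>

lemma inj_rearr: "inj (rearr :: 'a::linordered_ab_group_add list \<Rightarrow> _)"
proof (rule injI)
  fix xs ys :: "'a list"
  assume "rearr xs = rearr ys"
  then show "xs = ys"
  proof (induction xs arbitrary: ys)
    case Nil
    then show ?case by (cases ys) (auto split: if_splits)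
  next
    case (Cons x xs)
    show ?case
    proof (cases ys)
      case Nil
      then show ?thesis using Cons.prems by (auto split: if_splits)
    next
      case (Cons y ys')
      have "sum_list (x # xs) = sum_list ys"
        using Cons.prems by (metis sum_list_rearr)
      then show ?thesis
        using Cons.prems Cons.IH[of ys'] Cons by (auto split: if_splits intro: prod_eqI)
    qed
  qed
qed

text \<open>Undoes the map step by step: the sign of \<open>sum_list u + sum_list v\<close> selects
  the list that gives up its head, and the sign conditions ensure that this list is
  nonempty.\<close>

lemma rearr_surj:
  fixes u v :: "'a::linordered_ab_group_add list"
  assumes "all_suffix_sums (\<lambda>s. s > 0) u" and "all_suffix_sums (\<lambda>s. s \<le> 0) v"
  shows "\<exists>xs. rearr xs = (u, v)"
  using assms
proof (induction "length u + length v" arbitrary: u v)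
  case 0
  then show ?case by (intro exI[of _ "[]"]) simp
next
  case (Suc n)
  show ?case
  proof (cases "sum_list u + sum_list v > 0")
    case True
    have "sum_list v \<le> 0"
      using Suc.prems all_suffix_sums_sum_list[of "\<lambda>s. s \<le> 0" v] by auto
    with True obtain x u' where u: "u = x # u'" by (cases u) auto
    with Suc obtain xs where xs: "rearr xs = (u', v)" by fastforce
    have "sum_list xs = sum_list u' + sum_list v"
      using sum_list_rearr[of xs] xs by simp
    then have "rearr (x # xs) = (u, v)"
      using True xs u by (simp add: add.assoc)
    then show ?thesis by blast
  next
    case False
    have "v \<noteq> []"
    proof
      assume v: "v = []"
      then have "u \<noteq> []" using Suc.hyps by auto
      then show False
        using Suc.prems all_suffix_sums_sum_list[of "\<lambda>s. s > 0" u] False v by auto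
    qed
    then obtain x v' where v: "v = x # v'" by (cases v) auto
    with Suc obtain xs where xs: "rearr xs = (u, v')" by fastforce
    have "sum_list xs = sum_list u + sum_list v'"
      using sum_list_rearr[of xs] xs by simp
    then have "rearr (x # xs) = (u, v)"
      using False xs v by (simp add: add.left_commute)
    then show ?thesis by blast
  qed
qed

section \<open>Words of steps\<close>

lemma card_lists_two_letters:
  assumes "p \<noteq> q"
  shows "card {xs. set xs \<subseteq> {p, q} \<and> length xs = n \<and> count_list xs p = k} = n choose k"
proof (induction n arbitrary: k)
  case 0
  have "{xs. set xs \<subseteq> {p, q} \<and> length xs = 0 \<and> count_list xs p = k} = (if k = 0 then {[]} else {})"
    by auto
  then show ?case by simp
next
  case (Suc n)
  define S where "S k = {xs. set xs \<subseteq> {p, q} \<and> length xs = n \<and> count_list xs p = k}" for k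
  have fin: "finite (S k)" for k
    unfolding S_def by (rule finite_subset[OF _ finite_lists_length_eq[of "{p, q}" n]]) auto
  have S: "{xs. set xs \<subseteq> {p, q} \<and> length xs = Suc n \<and> count_list xs p = k} =
      (if k = 0 then {} else (#) p ` S (k - 1)) \<union> (#) q ` S k"
    using assms by (auto simp: S_def length_Suc_conv image_iff)
  have card: "card (S k) = n choose k" for k
    unfolding S_def by (rule Suc)
  have disj: "(#) p ` S m \<inter> (#) q ` S k = {}" for m
    using assms by auto
  show ?case
    unfolding S using disj card fin
    by (cases k) (simp_all add: card_Un_disjoint card_image)
qed

text \<open>Words list the steps of a path from the last to the first, encoded by the change of
  \<open>a y - b x\<close>, so that the suffix sums are the values of \<open>a y - b x\<close> at the points of the path.\<close>

definition words :: "nat \<Rightarrow> nat \<Rightarrow> nat \<Rightarrow> int list set" where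
  "words a b g = {xs. set xs \<subseteq> {int a, - int b} \<and> length xs = g * (a + b) \<and> sum_list xs = 0}"

definition nonpos_words :: "nat \<Rightarrow> nat \<Rightarrow> nat \<Rightarrow> int list set" where
  "nonpos_words a b g = {xs \<in> words a b g. all_suffix_sums (\<lambda>s. s \<le> 0) xs}"

definition primitive_words :: "nat \<Rightarrow> nat \<Rightarrow> nat \<Rightarrow> int list set" where
  "primitive_words a b g =
     {xs \<in> words a b g. \<forall>i\<in>{0<..<length xs}. sum_list (drop i xs) < 0}"

text \<open>For \<open>k < g * (a + b)\<close>: the paths without flaws whose last excursion has
  more than \<open>k\<close> steps, as dropping \<open>i\<close> letters leads to the point
  \<open>i\<close> steps before the end. The range starts at 1 because the endpoint itself lies on
  the diagonal.\<close>

definition delayed_words :: "nat \<Rightarrow> nat \<Rightarrow> nat \<Rightarrow> nat \<Rightarrow> int list set" where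
  "delayed_words a b k g =
     {xs \<in> nonpos_words a b g. \<forall>i\<in>{0<..k}. sum_list (drop i xs) < 0}"

lemma finite_words: "finite (words a b g)"
  unfolding words_def
  by (rule finite_subset[OF _ finite_lists_length_eq[of "{int a, - int b}" "g * (a + b)"]]) auto

lemma finite_nonpos_words: "finite (nonpos_words a b g)"
  unfolding nonpos_words_def using finite_words by auto

lemma finite_primitive_words: "finite (primitive_words a b g)"
  unfolding primitive_words_def using finite_words by auto

text \<open>Here \<open>a > 0\<close> keeps the letters \<open>int a\<close> and
  \<open>- int b\<close> distinct.\<close>

lemma sum_list_word:
  assumes "set xs \<subseteq> {int a, - int b}" and "a > 0"
  shows "sum_list xs = int a * int (count_list xs (int a)) - int b * int (count_list xs (- int b))"
    and "length xs = count_list xs (int a) + count_list xs (- int b)"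
  using assms by (induction xs) (auto simp: algebra_simps)

text \<open>Composition of two bijections: \<open>rearr\<close> onto the pairs \<open>U\<close>,
  then gluing a pair to \<open>rev u @ v\<close>. The gluing performs the reversal and the exchange
  of the two pieces at the first maximum at once.\<close>

lemma card_words_positive_suffix_sums:
  assumes "k < g * (a + b)"
  shows "card {xs \<in> words a b g. positive_suffix_sums xs = k} = card (delayed_words a b k g)"
proof -
  \<comment> \<open>The conditions on letters, total length and total sum depend only on the
    multiset of steps, which \<open>rearr\<close> preserves; the first list has one step per
    flaw.\<close>
  define U where "U = {(u, v). length u = k \<and> set u \<union> set v \<subseteq> {int a, - int b} \<and>
    length u + length v = g * (a + b) \<and> sum_list u + sum_list v = 0 \<and>
    all_suffix_sums (\<lambda>s. s > 0) u \<and> all_suffix_sums (\<lambda>s. s \<le> 0) v}"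
  have set_rearr: "set (fst (rearr xs)) \<union> set (snd (rearr xs)) = set xs" for xs :: "int list"
    using mset_rearr[of xs] by (metis set_mset_mset set_mset_union)
  have length_rearr: "positive_suffix_sums xs + length (snd (rearr xs)) = length xs"
    for xs :: "int list"
    using mset_rearr[of xs] by (metis length_fst_rearr size_mset size_union)
  have "bij_betw rearr {xs \<in> words a b g. positive_suffix_sums xs = k} U"
    unfolding bij_betw_def
  proof
    show "inj_on rearr {xs \<in> words a b g. positive_suffix_sums xs = k}"
      using inj_rearr by (rule inj_on_subset) simp
    have "rearr xs \<in> U \<longleftrightarrow> xs \<in> words a b g \<and> positive_suffix_sums xs = k" for xs
      by (simp add: U_def words_def case_prod_beta set_rearr length_rearr length_fst_rearr
          sum_list_rearr suffix_sums_rearr ) (metis Un_subset_iff set_rearr)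
    moreover have "\<exists>xs. rearr xs = p" if "p \<in> U" for p
      using that rearr_surj[of "fst p" "snd p"] by (auto simp: U_def)
    ultimately show "rearr ` {xs \<in> words a b g. positive_suffix_sums xs = k} = U"
      by (auto simp: image_iff) metis
  qed
  then have 1: "card {xs \<in> words a b g. positive_suffix_sums xs = k} = card U"
    by (rule bij_betw_same_card)
  \<comment> \<open>As the total is 0, what remains of \<open>rev u @ v\<close> after its first
    \<open>k - i\<close> letters is the negative of the suffix sum of \<open>u\<close> from
    \<open>i\<close>. The indices \<open>i < k\<close> of \<open>u\<close> thus match the positions
    \<open>1..k\<close> of the glued word.\<close>
  have pos_iff: "all_suffix_sums (\<lambda>s. s > 0) u \<longleftrightarrow>
      (\<forall>i\<in>{0<..k}. sum_list (drop i (rev u @ v)) < 0)"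
    if "length u = k" "sum_list u + sum_list v = 0" for u v :: "int list"
  proof -
    have drop: "sum_list (drop (k - i) (rev u @ v)) = - sum_list (drop i u)" if "i \<le> k" for i
    proof -
      have "drop (k - i) (rev u @ v) = rev (take i u) @ v"
        using that \<open>length u = k\<close> by (simp add: drop_rev)
      moreover have "sum_list u = sum_list (take i u) + sum_list (drop i u)"
        by (metis append_take_drop_id sum_list_append)
      ultimately show ?thesis using \<open>sum_list u + sum_list v = 0\<close> by (simp add: sum_list_rev)
    qed
    show ?thesis
    proof
      assume u: "all_suffix_sums (\<lambda>s. s > 0) u"
      show "\<forall>i\<in>{0<..k}. sum_list (drop i (rev u @ v)) < 0"
      proof
        fix i assume i: "i \<in> {0<..k}"
        then have "sum_list (drop (k - i) u) > 0"
          using u that by (simp add: all_suffix_sums_iff)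
        then show "sum_list (drop i (rev u @ v)) < 0"
          using drop[of "k - i"] i by simp
      qed
    next
      assume v: "\<forall>i\<in>{0<..k}. sum_list (drop i (rev u @ v)) < 0"
      show "all_suffix_sums (\<lambda>s. s > 0) u"
        unfolding all_suffix_sums_iff
      proof safe
        fix i assume "i < length u"
        then show "sum_list (drop i u) > 0"
          using drop[of i] v[rule_format, of "k - i"] that by auto
      qed
    qed
  qed
  have nonpos: "all_suffix_sums (\<lambda>s. s \<le> 0) (rev u @ v)"
    if "length u = k" "sum_list u + sum_list v = 0"
      "all_suffix_sums (\<lambda>s. s \<le> 0) v" "\<forall>i\<in>{0<..k}. sum_list (drop i (rev u @ v)) < 0"
    for u v :: "int list"
    unfolding all_suffix_sums_iff
  proof safe
    fix i assume i: "i < length (rev u @ v)"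
    consider "i = 0" | "i \<in> {0<..k}" | "i > k" by force
    then show "sum_list (drop i (rev u @ v)) \<le> 0"
    proof cases
      case 1
      then show ?thesis using that(2) by (simp add: sum_list_rev)
    next
      case 2
      then show ?thesis using that(4) by (meson less_imp_le)
    next
      case 3
      then show ?thesis using that(1,3) i by (simp add: all_suffix_sums_iff)
    qed
  qed
  \<comment> \<open>The cut position \<open>k\<close> is the same for all pairs, so the glued word
    determines both parts.\<close>
  have 2: "bij_betw (\<lambda>(u, v). rev u @ v) U (delayed_words a b k g)"
  proof (rule bij_betwI')
    fix p q assume "p \<in> U" "q \<in> U"
    then have "length (fst p) = length (fst q)"
      by (simp add: U_def case_prod_beta)
    then show "((\<lambda>(u, v). rev u @ v) p = (\<lambda>(u, v). rev u @ v) q) = (p = q)"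
      by (simp add: case_prod_beta prod_eq_iff)
  next
    fix p assume p: "p \<in> U"
    obtain u v where uv: "p = (u, v)" by (cases p)
    have "\<forall>i\<in>{0<..k}. sum_list (drop i (rev u @ v)) < 0"
      using p pos_iff[of u v] by (simp add: U_def uv)
    moreover from this have "all_suffix_sums (\<lambda>s. s \<le> 0) (rev u @ v)"
      using p nonpos[of u v] by (simp add: U_def uv)
    moreover have "rev u @ v \<in> words a b g"
      using p by (simp add: U_def uv words_def sum_list_rev)
    ultimately show "(\<lambda>(u, v). rev u @ v) p \<in> delayed_words a b k g"
      by (simp add: delayed_words_def nonpos_words_def uv)
  next
    fix ys assume ys: "ys \<in> delayed_words a b k g"
    define u v where "u = rev (take k ys)" and "v = drop k ys"
    have uv: "ys = rev u @ v" by (simp add: u_def v_def)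
    \<comment> \<open>This is where \<open>k < g * (a + b)\<close> enters: the word is long enough
      to be cut at \<open>k\<close>.\<close>
    have l: "length u = k"
      using ys assms by (simp add: u_def delayed_words_def nonpos_words_def words_def)
    have w: "rev u @ v \<in> words a b g" "all_suffix_sums (\<lambda>s. s \<le> 0) v"
      "\<forall>i\<in>{0<..k}. sum_list (drop i (rev u @ v)) < 0"
      using ys unfolding uv
      by (simp_all add: delayed_words_def nonpos_words_def all_suffix_sums_append)
    then have "sum_list u + sum_list v = 0"
      by (simp add: words_def sum_list_rev)
    with w l pos_iff[of u v] have "(u, v) \<in> U"
      by (simp add: U_def words_def)
    then show "\<exists>p\<in>U. ys = (\<lambda>(u, v). rev u @ v) p"
      using uv by force
  qed
  show ?thesis using 1 bij_betw_same_card[OF 2] by simp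
qed

text \<open>The letter counts satisfy \<open>a * p = b * q\<close>, so by coprimality they are a
  common multiple of \<open>b\<close> and \<open>a\<close>. Hence a path meets the diagonal only
  after a multiple of \<open>a + b\<close> steps.\<close>

lemma length_zero_word:
  assumes "coprime a b" "a > 0" and "set xs \<subseteq> {int a, - int b}" and "sum_list xs = 0"
  shows "(a + b) dvd length xs"
proof -
  define p q where "p = count_list xs (int a)" and "q = count_list xs (- int b)"
  have pq: "length xs = p + q" and "int a * int p = int b * int q"
    using sum_list_word[of xs a b] assms by (simp_all add: p_def q_def)
  then have eq: "a * p = b * q" by (metis of_nat_eq_iff of_nat_mult)
  then have "a dvd q"
    using assms(1) by (metis coprime_dvd_mult_right_iff dvd_triv_left)
  then obtain i where i: "q = a * i" ..
  then have "p = b * i" using eq assms(2) by simp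
  then show ?thesis using pq i by (metis add.commute add_mult_distrib dvd_triv_left)
qed

text \<open>The first return of a word to zero is the start of the last excursion of the path.\<close>

lemma card_delayed_words:
  assumes "coprime a b" "a > 0" and "k < g * (a + b)"
  shows "card (delayed_words a b k g) =
    (\<Sum>i | i \<le> g \<and> k < i * (a + b). card (primitive_words a b i) * card (nonpos_words a b (g - i)))"
proof -
  define I where "I = {i. i \<le> g \<and> k < i * (a + b)}"
  define S where
    "S = Sigma I (\<lambda>i. primitive_words a b i \<times> nonpos_words a b (g - i))"
  have "bij_betw (\<lambda>(i, xs, ys). xs @ ys) S (delayed_words a b k g)"
  proof (rule bij_betwI')
    \<comment> \<open>Of two factorizations with first factors of different lengths, the longer
      first factor would have a proper nonempty suffix of sum 0, contradicting primitivity. The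
      shorter one is nonempty because \<open>k < i * (a + b)\<close>.\<close>
    have *: "\<not> i < i'" if "(i, xs, ys) \<in> S" "(i', xs', ys') \<in> S" "xs @ ys = xs' @ ys'"
      for i xs ys i' xs' ys'
    proof
      assume "i < i'"
      have mem: "xs \<in> words a b i" "ys \<in> words a b (g - i)" "xs' \<in> words a b i'"
        "ys' \<in> words a b (g - i')" "xs' \<in> primitive_words a b i'" "i \<in> I"
        using that by (auto simp: S_def primitive_words_def nonpos_words_def)
      have l: "length xs = i * (a + b)" "length xs' = i' * (a + b)"
        using mem by (auto simp: words_def)
      have i: "i * (a + b) > 0" "i * (a + b) < i' * (a + b)"
        using mem(6) \<open>i < i'\<close> \<open>a > 0\<close> by (simp_all add: I_def, metis gr0I less_nat_zero_code mult_0)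
      have "ys = drop (length xs) (xs' @ ys')"
        by (metis append_eq_conv_conj that(3))
      then have "ys = drop (length xs) xs' @ ys'"
        using l i by simp
      then have "sum_list (drop (length xs) xs') = 0"
        using mem by (auto simp: words_def)
      moreover have "sum_list (drop (length xs) xs') < 0"
        using mem(5) i l by (auto simp: primitive_words_def)
      ultimately show False by simp
    qed
    fix p q assume pq: "p \<in> S" "q \<in> S"
    obtain i xs ys i' xs' ys' where p: "p = (i, xs, ys)" and q: "q = (i', xs', ys')"
      by (metis prod_cases3)
    show "((\<lambda>(i, xs, ys). xs @ ys) p = (\<lambda>(i, xs, ys). xs @ ys) q) = (p = q)"
    proof
      assume eq: "(\<lambda>(i, xs, ys). xs @ ys) p = (\<lambda>(i, xs, ys). xs @ ys) q"
      then have "i = i'"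
        using *[of i xs ys i' xs' ys'] *[of i' xs' ys' i xs ys] pq p q by force
      moreover from this have "length xs = length xs'"
        using pq p q by (auto simp: S_def primitive_words_def words_def)
      ultimately show "p = q" using eq p q by simp
    qed simp
  next
    fix p assume "p \<in> S"
    then obtain i xs ys where p: "p = (i, xs, ys)" and i: "i \<le> g" "k < i * (a + b)"
      and xs: "xs \<in> primitive_words a b i" and ys: "ys \<in> nonpos_words a b (g - i)"
      by (auto simp: S_def I_def)
    have l: "length xs = i * (a + b)" "length ys = (g - i) * (a + b)"
      and s: "sum_list xs = 0" "sum_list ys = 0"
      using xs ys by (auto simp: primitive_words_def nonpos_words_def words_def)
    have "all_suffix_sums (\<lambda>s. s \<le> 0) xs"
      unfolding all_suffix_sums_iff
    proof safe
      fix m assume "m < length xs"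
      then show "sum_list (drop m xs) \<le> 0"
        using xs s(1) less_imp_le[of "sum_list (drop m xs)" 0]
        by (cases "m = 0") (simp_all add: primitive_words_def)
    qed
    moreover have "i * (a + b) + (g - i) * (a + b) = g * (a + b)"
      using i by (metis add_mult_distrib le_add_diff_inverse)
    \<comment> \<open>Position \<open>m\<close> lies strictly inside the primitive factor, and
      \<open>ys\<close> contributes 0.\<close>
    moreover have "sum_list (drop m (xs @ ys)) < 0" if "m \<in> {0<..k}" for m
    proof -
      have "sum_list (drop m xs) < 0"
        using that xs i(2) l(1) by (simp add: primitive_words_def)
      then show ?thesis using that i(2) l(1) s(2) by simp
    qed
    ultimately show "(\<lambda>(i, xs, ys). xs @ ys) p \<in> delayed_words a b k g"
      using p xs ys l s
      by (auto simp: delayed_words_def nonpos_words_def primitive_words_def words_def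
          all_suffix_sums_append)
  next
    fix w assume w: "w \<in> delayed_words a b k g"
    \<comment> \<open>Position 0 is excluded since the whole word sums to 0. The empty suffix is
      always a zero, so a least one exists.\<close>
    define Z where "Z m \<longleftrightarrow> m > 0 \<and> sum_list (drop m w) = 0" for m
    have len: "length w = g * (a + b)" and w_set: "set w \<subseteq> {int a, - int b}"
      and w_sum: "sum_list w = 0" and w_np: "all_suffix_sums (\<lambda>s. s \<le> 0) w"
      using w by (auto simp: delayed_words_def nonpos_words_def words_def)
    have Z: "Z (length w)" unfolding Z_def using len assms(3) by (intro conjI) (linarith, simp)
    define m where "m = (LEAST m. Z m)"
    have m: "Z m" "m \<le> length w" and least: "\<And>l. l < m \<Longrightarrow> \<not> Z l"
      using Z by (auto simp: m_def intro: LeastI Least_le dest: not_less_Least)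
    define xs ys where "xs = take m w" and "ys = drop m w"
    have w_eq: "w = xs @ ys" and l: "length xs = m"
      using m by (simp_all add: xs_def ys_def)
    have ys_sum: "sum_list ys = 0" using m by (simp add: Z_def ys_def)
    then have xs_sum: "sum_list xs = 0" using w_sum w_eq by simp
    have sets: "set xs \<subseteq> {int a, - int b}" "set ys \<subseteq> {int a, - int b}"
      using w_set w_eq by auto
    obtain i where i: "m = i * (a + b)"
      using length_zero_word[OF assms(1,2) sets(1) xs_sum] l by (metis dvdE mult.commute)
    have "i * (a + b) \<le> g * (a + b)" using m(2) len i by simp
    then have ig: "i \<le> g" using assms(2) by auto
    \<comment> \<open>A delayed word is strictly negative at positions \<open>1..k\<close>, so its
      first zero lies beyond them.\<close>
    have "k < m"
    proof (rule ccontr)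
      assume "\<not> k < m"
      then have "m \<in> {0<..k}" using m(1) by (simp add: Z_def)
      moreover have "\<forall>i\<in>{0<..k}. sum_list (drop i w) < 0"
        using w by (simp add: delayed_words_def)
      ultimately have "sum_list (drop m w) < 0" by blast
      then show False using m(1) by (simp add: Z_def)
    qed
    then have "i \<in> I" using i ig by (simp add: I_def)
    moreover have "xs \<in> primitive_words a b i"
    proof -
      have "sum_list (drop l xs) < 0" if "l \<in> {0<..<length xs}" for l
      proof -
        have "sum_list (drop l w) \<noteq> 0" using least[of l] that l by (auto simp: Z_def)
        moreover have "sum_list (drop l w) \<le> 0"
          using w_np that m(2) l by (simp add: all_suffix_sums_iff)
        ultimately show ?thesis using that ys_sum w_eq l by simp
      qed
      then show ?thesis
        using sets xs_sum l i by (auto simp: primitive_words_def words_def)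
    qed
    moreover have "ys \<in> nonpos_words a b (g - i)"
      using w_np sets ys_sum len i ig l unfolding w_eq
      by (auto simp: nonpos_words_def words_def all_suffix_sums_append diff_mult_distrib)
    ultimately have "(i, xs, ys) \<in> S" by (simp add: S_def)
    then show "\<exists>p\<in>S. w = (\<lambda>(i, xs, ys). xs @ ys) p"
      using w_eq by force
  qed
  then have "card (delayed_words a b k g) = card S"
    by (simp add: bij_betw_same_card)
  also have "\<dots> = (\<Sum>i\<in>I. card (primitive_words a b i) * card (nonpos_words a b (g - i)))"
    unfolding S_def
    by (subst card_SigmaI)
      (auto simp: I_def card_cartesian_product finite_primitive_words finite_nonpos_words)
  finally show ?thesis by (simp add: I_def)
qed

section \<open>Paths and their flaws\<close>

definition endpoint :: "nat \<Rightarrow> nat \<Rightarrow> int list \<Rightarrow> int \<times> int" where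
  "endpoint a b xs = (int (count_list xs (- int b)), int (count_list xs (int a)))"

text \<open>The recursion runs from the end of the path back to the origin, so \<open>rev\<close> of
  this list is the path.\<close>

fun visited :: "nat \<Rightarrow> nat \<Rightarrow> int list \<Rightarrow> (int \<times> int) list" where
  "visited a b [] = [(0, 0)]"
| "visited a b (x # xs) = endpoint a b (x # xs) # visited a b xs"

lemma visited_nonempty: "visited a b xs \<noteq> []"
  by (cases xs) auto

lemma hd_visited: "hd (visited a b xs) = endpoint a b xs"
  by (cases xs) (auto simp: endpoint_def)

lemma last_visited: "last (visited a b xs) = (0, 0)"
  by (induction xs) (auto simp: visited_nonempty)

lemma endpoint_Cons:
  assumes "x \<in> {int a, - int b}" and "a > 0"
  shows "endpoint a b (x # xs) = endpoint a b xs + (if x = int a then (0, 1) else (1, 0))"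
  using assms by (auto simp: endpoint_def)

lemma inj_on_visited:
  assumes "a > 0"
  shows "inj_on (visited a b) {xs. set xs \<subseteq> {int a, - int b}}"
proof -
  have "xs = ys" if "set xs \<subseteq> {int a, - int b}" "set ys \<subseteq> {int a, - int b}"
    "visited a b xs = visited a b ys" for xs ys
    using that
  proof (induction xs arbitrary: ys)
    case Nil
    then show ?case by (cases ys) (auto simp: visited_nonempty[symmetric])
  next
    case (Cons x xs)
    then obtain y ys' where ys: "ys = y # ys'"
      by (cases ys) (auto simp: visited_nonempty)
    with Cons have xs: "xs = ys'" by auto
    have "endpoint a b (x # xs) = endpoint a b (y # xs)"
      using Cons.prems(3) ys xs by simp
    moreover have "x \<in> {int a, - int b}" "y \<in> {int a, - int b}"
      using Cons.prems ys by auto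
    ultimately have "x = y"
      using \<open>a > 0\<close> by (simp add: endpoint_Cons split: if_splits)
    then show ?case using ys xs by simp
  qed
  then show ?thesis by (auto intro: inj_onI)
qed

lemma lattice_path_visited:
  assumes "set xs \<subseteq> {int a, - int b}" and "a > 0"
  shows "lattice_path (rev (visited a b xs))"
proof -
  have "successively (\<lambda>u v. u - v \<in> {(1, 0), (0, 1)}) (visited a b xs)"
    using assms(1)
  proof (induction xs)
    case (Cons x xs)
    then show ?case
      using endpoint_Cons[of x a b xs] assms(2) visited_nonempty[of a b xs]
      by (auto simp: successively_Cons hd_visited)
  qed simp
  then show ?thesis
    by (simp add: lattice_path_def visited_nonempty)
qed

lemma lattice_path_conv_visited:
  assumes "lattice_path p" and "hd p = (0, 0)" and "a > 0"
  shows "\<exists>xs. set xs \<subseteq> {int a, - int b} \<and> p = rev (visited a b xs)"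
proof -
  have "\<exists>xs. set xs \<subseteq> {int a, - int b} \<and> visited a b xs = q"
    if "successively (\<lambda>u v. u - v \<in> {(1, 0), (0, 1)}) q" "q \<noteq> []" "last q = (0, 0)" for q
    using that
  proof (induction q rule: induct_list012)
    case (2 u)
    then show ?case by (intro exI[of _ "[]"]) simp
  next
    case (3 u v q)
    then obtain xs where xs: "set xs \<subseteq> {int a, - int b}" "visited a b xs = v # q"
      by auto
    then have v: "v = endpoint a b xs" using hd_visited[of a b xs] by simp
    define x where "x = (if u - v = (0, 1) then int a else - int b)"
    have "x \<in> {int a, - int b}" by (simp add: x_def)
    moreover have "endpoint a b (x # xs) = u"
      using 3 endpoint_Cons[of x a b xs] assms(3) v
      by (auto simp: x_def prod_eq_iff split: if_splits)
    ultimately show ?case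
      using xs by (intro exI[of _ "x # xs"]) auto
  qed simp
  from this[of "rev p"] assms show ?thesis
    by (auto simp: lattice_path_def last_rev)
qed

text \<open>The left side counts a set, the right side counts positions of a list. They agree
  because the coordinate sum of a point is the number of steps taken, so no point is visited
  twice.\<close>

lemma card_above_visited:
  assumes "set xs \<subseteq> {int a, - int b}" and "a > 0"
  shows "card {u \<in> set (visited a b xs). int b * fst u < int a * snd u} = positive_suffix_sums xs"
  using assms(1)
proof (induction xs)
  case (Cons x xs)
  have sum: "sum_list (x # xs) = int a * snd (endpoint a b (x # xs)) - int b * fst (endpoint a b (x # xs))"
    using sum_list_word(1)[OF Cons.prems assms(2)] by (simp only: endpoint_def fst_conv snd_conv)
  have "fst u + snd u \<le> int (length ys)"
    if "set ys \<subseteq> {int a, - int b}" "u \<in> set (visited a b ys)" for u ys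
    using that
  proof (induction ys)
    case (Cons y ys)
    then show ?case
      using sum_list_word(2)[OF Cons.prems(1) assms(2)]
      by (auto simp: endpoint_def simp del: count_list.simps)
  qed simp
  moreover have "fst (endpoint a b (x # xs)) + snd (endpoint a b (x # xs)) = int (length (x # xs))"
    using sum_list_word(2)[OF Cons.prems assms(2)] unfolding endpoint_def by simp
  ultimately have new: "endpoint a b (x # xs) \<notin> set (visited a b xs)"
    using Cons.prems by fastforce
  have "{u \<in> set (visited a b (x # xs)). int b * fst u < int a * snd u} =
    (if sum_list (x # xs) > 0 then {endpoint a b (x # xs)} else {}) \<union>
    {u \<in> set (visited a b xs). int b * fst u < int a * snd u}"
    unfolding sum by auto
  then show ?case
    using Cons new by (simp del: sum_list.Cons)
qed simp

text \<open>The point of the segment over \<open>x\<close> has parameter \<open>x / X\<close>;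
  multiplying by \<open>X > 0\<close> clears the denominator and leaves the sign of a linear
  form.\<close>

lemma strictly_above_segment_iff:
  fixes X Y x y :: real
  assumes "X > 0" and "0 \<le> x" and "x \<le> X"
  shows "strictly_above (x, y) (closed_segment (0, 0) (X, Y)) \<longleftrightarrow> Y * x < X * y"
proof
  assume "strictly_above (x, y) (closed_segment (0, 0) (X, Y))"
  then obtain t where "x = t * X" "t * Y < y"
    by (auto simp: strictly_above_def closed_segment_def zero_prod_def)
  then show "Y * x < X * y"
    using mult_strict_left_mono[of "t * Y" y X] assms(1) by (simp add: mult_ac)
next
  assume less: "Y * x < X * y"
  define t where "t = x / X"
  have "t * X = x" "0 \<le> t" "t \<le> 1" "t * Y < y"
    using assms less by (auto simp: t_def field_simps)
  then have "(x, t * Y) \<in> closed_segment (0, 0) (X, Y)"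
    by (auto simp: closed_segment_def zero_prod_def)
  with \<open>t * Y < y\<close> show "strictly_above (x, y) (closed_segment (0, 0) (X, Y))"
    by (auto simp: strictly_above_def)
qed

lemma fst_visited_bounds:
  assumes "u \<in> set (visited a b xs)"
  shows "0 \<le> fst u" and "fst u \<le> fst (endpoint a b xs)"
  using assms by (induction xs) (auto simp: endpoint_def split: if_splits)

text \<open>With \<open>p\<close> up and \<open>q\<close> right steps, zero sum gives
  \<open>(a + b) * p = b * (p + q)\<close>, so the length determines \<open>p\<close> and then
  \<open>q\<close>.\<close>

lemma endpoint_word_iff:
  assumes "set xs \<subseteq> {int a, - int b}" and "a > 0"
  shows "endpoint a b xs = (int (g * a), int (g * b)) \<longleftrightarrow> xs \<in> words a b g"
proof -
  define p q where "p = count_list xs (int a)" and "q = count_list xs (- int b)"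
  have pq: "length xs = p + q" "sum_list xs = int a * int p - int b * int q"
    using sum_list_word[of xs a b] assms by (simp_all add: p_def q_def)
  have "p = g * b \<and> q = g * a" if "p + q = g * (a + b)" "int a * int p = int b * int q"
  proof -
    have "a * p = b * q" using that(2) by (metis of_nat_eq_iff of_nat_mult)
    then have "(a + b) * p = b * (p + q)" by (simp add: algebra_simps)
    then have "(a + b) * p = (a + b) * (g * b)" by (simp add: that(1) algebra_simps)
    then have "p = g * b" using assms(2) by (metis add_is_0 mult_cancel1 less_irrefl)
    with that(1) show ?thesis by (simp add: algebra_simps)
  qed
  then have iff: "q = g * a \<and> p = g * b \<longleftrightarrow>
      p + q = g * (a + b) \<and> int a * int p - int b * int q = 0"
    by (auto simp: algebra_simps)
  have "endpoint a b xs = (int q, int p)"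
    by (simp add: endpoint_def p_def q_def)
  then show ?thesis
    using assms(1) iff unfolding words_def pq mem_Collect_eq
    by (simp del: of_nat_mult)
qed

lemma card_flaws_visited:
  assumes "xs \<in> words a b g" and "a > 0" and "g > 0"
  shows "card (flaws (rev (visited a b xs))) = positive_suffix_sums xs"
proof -
  have xs: "set xs \<subseteq> {int a, - int b}" using assms(1) by (simp add: words_def)
  have e: "endpoint a b xs = (int (g * a), int (g * b))"
    using endpoint_word_iff[OF xs assms(2)] assms(1) by simp
  have "strictly_above (real_point u) (closed_segment (0, 0) (real (g * a), real (g * b)))
      \<longleftrightarrow> int b * fst u < int a * snd u" if "u \<in> set (visited a b xs)" for u
  proof -
    have "strictly_above (real_point u) (closed_segment (0, 0) (real (g * a), real (g * b)))
      \<longleftrightarrow> real (g * b) * real_of_int (fst u) < real (g * a) * real_of_int (snd u)"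
      unfolding real_point_def
    proof (rule strictly_above_segment_iff)
      show "real (g * a) > 0" using assms(2,3) by simp
      show "0 \<le> real_of_int (fst u)" using fst_visited_bounds(1)[OF that] by simp
      have "fst u \<le> int (g * a)" using fst_visited_bounds(2)[OF that] unfolding e by simp
      then show "real_of_int (fst u) \<le> real (g * a)" by (metis of_int_le_iff of_int_of_nat_eq)
    qed
    \<comment> \<open>The common factor \<open>g\<close> of both endpoint coordinates
      cancels.\<close>
    also have "\<dots> \<longleftrightarrow> real g * real_of_int (int b * fst u) < real g * real_of_int (int a * snd u)"
      by (simp add: mult.assoc)
    also have "\<dots> \<longleftrightarrow> int b * fst u < int a * snd u"
      using assms(3) by (simp only: mult_less_cancel_left_pos of_nat_0_less_iff of_int_less_iff)
    finally show ?thesis .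
  qed
  moreover have "real_point (hd (rev (visited a b xs))) = (0, 0)"
    by (simp add: hd_rev last_visited real_point_def)
  moreover have "real_point (last (rev (visited a b xs))) = (real (g * a), real (g * b))"
    by (simp add: last_rev hd_visited real_point_def e)
  ultimately have "flaws (rev (visited a b xs)) =
      {u \<in> set (visited a b xs). int b * fst u < int a * snd u}"
    by (auto simp: flaws_def)
  then show ?thesis using card_above_visited[OF xs assms(2)] by simp
qed

lemma card_paths_with_flaws:
  assumes "a > 0" and "g > 0"
  shows "card (paths_with_flaws a b k g) = card {xs \<in> words a b g. positive_suffix_sums xs = k}"
proof -
  have "paths_with_flaws a b k g =
      (rev \<circ> visited a b) ` {xs \<in> words a b g. positive_suffix_sums xs = k}"
  proof (intro set_eqI iffI)
    fix p assume p: "p \<in> paths_with_flaws a b k g"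
    then obtain xs where xs: "set xs \<subseteq> {int a, - int b}" "p = rev (visited a b xs)"
      using lattice_path_conv_visited[of p a b] assms by (auto simp: paths_with_flaws_def)
    have "endpoint a b xs = (int (g * a), int (g * b))"
      using p xs(2) by (simp add: paths_with_flaws_def last_rev hd_visited)
    then have w: "xs \<in> words a b g" using endpoint_word_iff xs(1) assms(1) by blast
    then have "positive_suffix_sums xs = k"
      using p card_flaws_visited[OF w assms] xs(2) by (simp add: paths_with_flaws_def)
    with w xs(2) show "p \<in> (rev \<circ> visited a b) ` {xs \<in> words a b g. positive_suffix_sums xs = k}"
      by auto
  next
    fix p assume "p \<in> (rev \<circ> visited a b) ` {xs \<in> words a b g. positive_suffix_sums xs = k}"
    then obtain xs where xs: "xs \<in> words a b g" "positive_suffix_sums xs = k"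
      and p: "p = rev (visited a b xs)" by auto
    have s: "set xs \<subseteq> {int a, - int b}" using xs(1) by (simp add: words_def)
    have "endpoint a b xs = (int (g * a), int (g * b))"
      using endpoint_word_iff[OF s assms(1)] xs(1) by blast
    then show "p \<in> paths_with_flaws a b k g"
      using lattice_path_visited[OF s assms(1)] card_flaws_visited[OF xs(1) assms] xs(2)
      by (simp add: paths_with_flaws_def p hd_rev last_rev last_visited hd_visited)
  qed
  moreover have "inj_on (rev \<circ> visited a b) {xs \<in> words a b g. positive_suffix_sums xs = k}"
    using inj_on_visited[OF assms(1), of b]
    by (intro comp_inj_on) (auto simp: words_def inj_on_def)
  ultimately show ?thesis by (simp only: card_image)
qed

section \<open>Sums over partitions\<close>

text \<open>A general weight \<open>f\<close> lets one recursion serve both \<open>c\<close> and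
  \<open>- c\<close>.\<close>

definition part_weight :: "(nat \<Rightarrow> real) \<Rightarrow> nat multiset \<Rightarrow> real" where
  "part_weight f P = (\<Prod>i\<in>set_mset P. f i ^ count P i / fact (count P i))"

text \<open>By the exponential formula, the coefficient of \<open>x^n\<close> in the exponential of
  \<open>\<Sum>i\<ge>1. f i * x^i\<close>.\<close>

definition part_sum :: "(nat \<Rightarrow> real) \<Rightarrow> nat \<Rightarrow> real" where
  "part_sum f n = (\<Sum>P\<in>partitions n. part_weight f P)"

lemma part_weight_superset:
  assumes "finite A" and "set_mset P \<subseteq> A"
  shows "part_weight f P = (\<Prod>i\<in>A. f i ^ count P i / fact (count P i))"
  unfolding part_weight_def
  using assms by (intro prod.mono_neutral_left) (auto simp: not_in_iff)

text \<open>Raising a multiplicity from \<open>m\<close> to \<open>m + 1\<close> multiplies the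
  weight by \<open>f i / (m + 1)\<close>; the new multiplicity cancels this denominator.\<close>

lemma part_weight_add_mset:
  "real (count (add_mset i Q) i) * part_weight f (add_mset i Q) = f i * part_weight f Q"
proof -
  define A where "A = set_mset Q - {i}"
  have A: "finite A" "i \<notin> A" "finite (insert i A)"
    and sub: "set_mset (add_mset i Q) \<subseteq> insert i A" "set_mset Q \<subseteq> insert i A"
    by (auto simp: A_def)
  have "(\<Prod>j\<in>A. f j ^ count (add_mset i Q) j / fact (count (add_mset i Q) j)) =
      (\<Prod>j\<in>A. f j ^ count Q j / fact (count Q j))"
    using A(2) by (intro prod.cong) auto
  then have "part_weight f (add_mset i Q) =
      f i ^ Suc (count Q i) / fact (Suc (count Q i)) * (\<Prod>j\<in>A. f j ^ count Q j / fact (count Q j))"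
    unfolding part_weight_superset[OF A(3) sub(1)] prod.insert[OF A(1,2)] by simp
  moreover have "part_weight f Q =
      f i ^ count Q i / fact (count Q i) * (\<Prod>j\<in>A. f j ^ count Q j / fact (count Q j))"
    unfolding part_weight_superset[OF A(3) sub(2)] prod.insert[OF A(1,2)] ..
  moreover have "real (Suc m) * (x ^ Suc m / fact (Suc m) * y) = x * (x ^ m / fact m * y)"
    for m and x y :: real
    by (simp add: field_simps del: of_nat_Suc)
  ultimately show ?thesis by (simp del: of_nat_Suc power_Suc fact_Suc)
qed

lemma sum_mset_conv_sum:
  fixes P :: "nat multiset"
  assumes "finite A" and "set_mset P \<subseteq> A"
  shows "sum_mset P = (\<Sum>i\<in>A. count P i * i)"
  using assms(2)
proof (induction P)
  case (add x P)
  have "(\<Sum>i\<in>A. count (add_mset x P) i * i) = (\<Sum>i\<in>A. (if x = i then i else 0) + count P i * i)"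
    by (intro sum.cong) auto
  also have "\<dots> = x + (\<Sum>i\<in>A. count P i * i)"
    using add.prems assms(1) by (simp add: sum.distrib)
  finally show ?case using add by simp
qed simp

lemma part_sum_0: "part_sum f 0 = 1"
proof -
  have "partitions 0 = {{#}}"
    using size_le_partition[of _ 0] by (fastforce simp: partitions_def)
  then show ?thesis by (simp add: part_sum_def part_weight_def)
qed

text \<open>Write \<open>n\<close> as the sum of \<open>i\<close> times its multiplicity in
  \<open>P\<close>. The multiplicity is absorbed by removing one copy of \<open>i\<close>, and the
  pairs \<open>(P, i)\<close> with \<open>i\<close> a part of \<open>P\<close> correspond to pairs
  of \<open>i\<close> and a partition of \<open>n - i\<close>.\<close>

lemma part_sum_rec: "real n * part_sum f n = (\<Sum>i=0..n. real i * f i * part_sum f (n - i))"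
proof -
  have 1: "real n * part_weight f P = (\<Sum>i\<in>set_mset P. real i * f i * part_weight f (P - {#i#}))"
    if "P \<in> partitions n" for P
  proof -
    have "n = (\<Sum>i\<in>set_mset P. count P i * i)"
      using that sum_mset_conv_sum[of "set_mset P" P] by (simp add: partitions_def)
    then have n: "real n = (\<Sum>i\<in>set_mset P. real (count P i) * real i)"
      by (simp flip: of_nat_mult of_nat_sum)
    have "real n * part_weight f P =
        (\<Sum>i\<in>set_mset P. real i * (real (count P i) * part_weight f P))"
      unfolding n sum_distrib_right by (intro sum.cong) simp_all
    also have "\<dots> = (\<Sum>i\<in>set_mset P. real i * f i * part_weight f (P - {#i#}))"
    proof (rule sum.cong)
      fix i assume "i \<in># P"
      then show "real i * (real (count P i) * part_weight f P) =
          real i * f i * part_weight f (P - {#i#})"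
        using part_weight_add_mset[of i "P - {#i#}" f] by simp
    qed simp
    finally show ?thesis .
  qed
  have 2: "1 \<le> i \<and> i \<le> n \<and> P - {#i#} \<in> partitions (n - i)"
    if P: "P \<in> partitions n" "i \<in># P" for P i
  proof -
    obtain Q where "P = add_mset i Q" using P(2) by (rule mset_add)
    then show ?thesis using P(1) by (auto simp: partitions_def)
  qed
  have 3: "add_mset i Q \<in> partitions n" if "1 \<le> i" "i \<le> n" "Q \<in> partitions (n - i)" for i Q
    using that by (auto simp: partitions_def)
  have "real n * part_sum f n =
      (\<Sum>(P, i)\<in>Sigma (partitions n) set_mset. real i * f i * part_weight f (P - {#i#}))"
    by (simp add: part_sum_def sum_distrib_left 1 sum.Sigma finite_partitions)
  also have "\<dots> = (\<Sum>(i, Q)\<in>Sigma {1..n} (\<lambda>i. partitions (n - i)). real i * f i * part_weight f Q)"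
    by (rule sum.reindex_bij_witness
          [of _ "\<lambda>(i, Q). (add_mset i Q, i)" "\<lambda>(P, i). (i, P - {#i#})"])
      (use 2 3 in auto)
  also have "\<dots> = (\<Sum>i=1..n. real i * f i * part_sum f (n - i))"
    by (simp add: part_sum_def sum_distrib_left sum.Sigma finite_partitions)
  \<comment> \<open>Adding the vanishing term \<open>i = 0\<close> gives the form of a Cauchy
    product.\<close>
  also have "\<dots> = (\<Sum>i=0..n. real i * f i * part_sum f (n - i))"
    by (simp add: sum.atLeast_Suc_atMost)
  finally show ?thesis .
qed

section \<open>Power series and their Euler derivatives\<close>

lemma fps_euler_deriv_nth: "fps_nth (fps_X * fps_deriv F) n = real n * fps_nth F n"
  by (cases n) auto

text \<open>The recursion \<open>part_sum_rec\<close> in power series form; it is the differential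
  equation of the exponential of \<open>\<Sum>i\<ge>1. f i * x^i\<close>.\<close>

lemma fps_deriv_part_sum:
  "fps_X * fps_deriv (Abs_fps (part_sum f)) = Abs_fps (\<lambda>i. real i * f i) * Abs_fps (part_sum f)"
proof (rule fps_ext)
  fix n
  show "fps_nth (fps_X * fps_deriv (Abs_fps (part_sum f))) n =
      fps_nth (Abs_fps (\<lambda>i. real i * f i) * Abs_fps (part_sum f)) n"
    unfolding fps_euler_deriv_nth by (simp add: fps_mult_nth part_sum_rec)
qed

text \<open>Since \<open>D\<close> has constant term 0, the equation expresses \<open>n\<close>
  times the \<open>n\<close>-th coefficient through earlier coefficients only.\<close>

lemma fps_euler_deriv_unique:
  fixes F G :: "real fps"
  assumes "fps_X * fps_deriv F = D * F" and "fps_X * fps_deriv G = D * G"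
    and "fps_nth F 0 = fps_nth G 0" and "fps_nth D 0 = 0"
  shows "F = G"
proof (rule fps_ext)
  fix n
  show "fps_nth F n = fps_nth G n"
  proof (induction n rule: less_induct)
    case (less n)
    show ?case
    proof (cases "n = 0")
      case False
      have "real n * fps_nth F n = (\<Sum>i=0..n. fps_nth D i * fps_nth F (n - i))"
        using fps_euler_deriv_nth[of F n] by (simp add: assms(1) fps_mult_nth)
      also have "\<dots> = (\<Sum>i=0..n. fps_nth D i * fps_nth G (n - i))"
      proof (rule sum.cong)
        fix i assume "i \<in> {0..n}"
        then show "fps_nth D i * fps_nth F (n - i) = fps_nth D i * fps_nth G (n - i)"
          using less[of "n - i"] assms(4) False by (cases "i = 0") auto
      qed simp
      also have "\<dots> = real n * fps_nth G n"
        using fps_euler_deriv_nth[of G n] by (simp add: assms(2) fps_mult_nth)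
      finally show ?thesis using False by simp
    qed (use assms in simp)
  qed
qed

text \<open>The logarithmic derivatives of the two factors cancel, so the product has Euler
  derivative 0 and equals its constant term.\<close>

lemma part_sum_uminus:
  "Abs_fps (part_sum f) * Abs_fps (part_sum (\<lambda>i. - f i)) = 1"
proof (rule fps_euler_deriv_unique[where D = 0])
  let ?F = "Abs_fps (part_sum f)" and ?G = "Abs_fps (part_sum (\<lambda>i. - f i))"
  let ?D = "Abs_fps (\<lambda>i. real i * f i)"
  have D: "Abs_fps (\<lambda>i. real i * - f i) = - ?D"
    by (rule fps_ext) simp
  have "fps_X * fps_deriv (?F * ?G) = ?F * (fps_X * fps_deriv ?G) + fps_X * fps_deriv ?F * ?G"
    by (simp add: algebra_simps)
  also have "\<dots> = 0"
    unfolding fps_deriv_part_sum D by (simp add: algebra_simps)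
  finally show "fps_X * fps_deriv (?F * ?G) = 0 * (?F * ?G)" by simp
qed (simp_all add: part_sum_0)

section \<open>\<open>H\<close> and \<open>E\<close> as coefficients of exponentials\<close>

lemma H_conv_part_sum: "H a b n = part_sum (c a b) n"
  by (simp add: H_def part_sum_def c_part_def part_weight_def)

text \<open>The signs combine to \<open>(-1) ^ size P\<close>, which distributes over the parts and
  turns each \<open>c\<close> into \<open>- c\<close>. As \<open>size P \<le> n\<close>, the
  difference \<open>n - size P\<close> is not truncated.\<close>

lemma E_conv_part_sum: "(-1) ^ n * E a b n = part_sum (\<lambda>i. - c a b i) n"
proof (cases "n = 0")
  case False
  have "(-1) ^ n * ((-1) ^ (n - size P) * c_part a b P) = part_weight (\<lambda>i. - c a b i) P"
    if "P \<in> partitions n" for P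
  proof -
    obtain m where m: "n = size P + m"
      using size_le_partition[OF \<open>P \<in> partitions n\<close>] le_Suc_ex by blast
    have "(-1 :: real) ^ n * (-1) ^ (n - size P) = (-1) ^ size P"
      unfolding m by (simp add: power_add mult.assoc flip: power_mult_distrib)
    also have "\<dots> = (\<Prod>i\<in>set_mset P. (-1) ^ count P i)"
      by (simp add: size_multiset_overloaded_eq power_sum)
    finally have "(-1) ^ n * ((-1) ^ (n - size P) * c_part a b P) =
        (\<Prod>i\<in>set_mset P. (-1) ^ count P i * (c a b i ^ count P i / fact (count P i)))"
      unfolding c_part_def prod.distrib by (simp flip: mult.assoc)
    then show ?thesis
      by (simp add: part_weight_def power_minus[of "c a b _"])
  qed
  then show ?thesis
    using False by (simp add: E_def part_sum_def sum_distrib_left)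
qed (simp add: E_def part_sum_0)

section \<open>Generating functions\<close>

text \<open>The case \<open>k = 0\<close> of the factorization, where the condition on the last
  excursion is vacuous.\<close>

lemma card_nonpos_words_rec:
  assumes "coprime a b" and "a > 0" and "g > 0"
  shows "card (nonpos_words a b g) =
    (\<Sum>i=1..g. card (primitive_words a b i) * card (nonpos_words a b (g - i)))"
proof -
  have "delayed_words a b 0 g = nonpos_words a b g"
    by (simp add: delayed_words_def)
  moreover have "{i. i \<le> g \<and> 0 < i * (a + b)} = {1..g}"
    using assms by auto
  ultimately show ?thesis
    using card_delayed_words[of a b 0 g] assms by simp
qed

text \<open>The longest suffix is the word itself; its sum is 0 and so it is not counted.\<close>

lemma positive_suffix_sums_word_less:
  assumes "xs \<in> words a b g" and "a > 0" and "g > 0"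
  shows "positive_suffix_sums xs < g * (a + b)"
proof (cases xs)
  case Nil
  then show ?thesis using assms by (simp add: words_def)
next
  case (Cons x ys)
  then have "positive_suffix_sums xs = positive_suffix_sums ys"
    using assms by (simp add: words_def)
  then show ?thesis
    using assms positive_suffix_sums_le[of ys] Cons by (simp add: words_def)
qed

text \<open>Sum the counts of words with \<open>k\<close> flaws over all \<open>k\<close> and
  exchange the sums: the term of index \<open>i\<close> occurs once for each
  \<open>k < i * (a + b)\<close>.\<close>

lemma card_words_rec:
  assumes "coprime a b" and "a > 0" and "g > 0"
  shows "card (words a b g) =
    (\<Sum>i\<le>g. i * (a + b) * (card (primitive_words a b i) * card (nonpos_words a b (g - i))))"
proof -
  let ?n = "g * (a + b)"
  let ?f = "\<lambda>i. card (primitive_words a b i) * card (nonpos_words a b (g - i))"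
  have "words a b g = (\<Union>k<?n. {xs \<in> words a b g. positive_suffix_sums xs = k})"
    using positive_suffix_sums_word_less assms by blast
  also have "card \<dots> = (\<Sum>k<?n. card {xs \<in> words a b g. positive_suffix_sums xs = k})"
    by (intro card_UN_disjoint) (auto simp: finite_words)
  also have "\<dots> = (\<Sum>k<?n. \<Sum>i | i \<in> {..g} \<and> k < i * (a + b). ?f i)"
    using assms by (intro sum.cong) (simp_all add: card_words_positive_suffix_sums card_delayed_words)
  also have "\<dots> = (\<Sum>i\<le>g. \<Sum>k | k \<in> {..<?n} \<and> k < i * (a + b). ?f i)"
    by (rule sum.swap_restrict) auto
  also have "\<dots> = (\<Sum>i\<le>g. i * (a + b) * ?f i)"
  proof (rule sum.cong)
    fix i assume "i \<in> {..g}"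
    \<comment> \<open>As \<open>i \<le> g\<close>, the bound \<open>k < i * (a + b)\<close> already
      implies \<open>k < ?n\<close>.\<close>
    then have "i * (a + b) \<le> ?n" by simp
    then have "k \<in> {..<?n} \<and> k < i * (a + b) \<longleftrightarrow> k < i * (a + b)" for k
      by (meson lessThan_iff less_le_trans)
    then have "{k. k \<in> {..<?n} \<and> k < i * (a + b)} = {k. k < i * (a + b)}"
      by (simp only:)
    then show "(\<Sum>k | k \<in> {..<?n} \<and> k < i * (a + b). ?f i) = i * (a + b) * ?f i"
      by (simp only: sum_constant card_Collect_less_nat of_nat_id)
  qed simp
  finally show ?thesis .
qed

text \<open>The right steps are the ones counted, to match the lower index \<open>i * a\<close> of
  the binomial in \<open>c\<close>.\<close>

lemma card_words:
  assumes "a > 0"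
  shows "card (words a b g) = (g * (a + b)) choose (g * a)"
proof -
  have "xs \<in> words a b g \<longleftrightarrow>
      set xs \<subseteq> {- int b, int a} \<and> length xs = g * (a + b) \<and> count_list xs (- int b) = g * a" for xs
  proof (cases "set xs \<subseteq> {int a, - int b}")
    case True
    then have "xs \<in> words a b g \<longleftrightarrow> count_list xs (- int b) = g * a \<and> count_list xs (int a) = g * b"
      using endpoint_word_iff[OF True assms, of g] by (simp add: endpoint_def del: of_nat_mult)
    then show ?thesis
      using sum_list_word(2)[OF True assms] True
      by (simp add: insert_commute algebra_simps) linarith
  qed (simp add: words_def insert_commute)
  then have "words a b g =
      {xs. set xs \<subseteq> {- int b, int a} \<and> length xs = g * (a + b) \<and> count_list xs (- int b) = g * a}"
    by blast
  then show ?thesis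
    using assms card_lists_two_letters[of "- int b" "int a"] by simp
qed

definition nonpos_fps :: "nat \<Rightarrow> nat \<Rightarrow> real fps" where
  "nonpos_fps a b = Abs_fps (\<lambda>g. real (card (nonpos_words a b g)))"

text \<open>The empty word lies in \<open>primitive_words a b 0\<close> but is not an excursion, hence the exception.\<close>

definition primitive_fps :: "nat \<Rightarrow> nat \<Rightarrow> real fps" where
  "primitive_fps a b = Abs_fps (\<lambda>g. if g = 0 then 0 else real (card (primitive_words a b g)))"

context
  fixes a b :: nat
  assumes pos: "a > 0" and coprime: "coprime a b"
begin

text \<open>Coefficientwise, \<open>Z = 1 + P * Z\<close> is the recursion for words without flaws,
  where the 1 stands for the empty word.\<close>

lemma nonpos_fps_mult_primitive: "nonpos_fps a b * (1 - primitive_fps a b) = 1"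
proof -
  have "nonpos_fps a b = 1 + primitive_fps a b * nonpos_fps a b"
  proof (rule fps_ext)
    fix g
    show "fps_nth (nonpos_fps a b) g = fps_nth (1 + primitive_fps a b * nonpos_fps a b) g"
    proof (cases "g = 0")
      case True
      have "nonpos_words a b 0 = {[]}" by (auto simp: nonpos_words_def words_def)
      then show ?thesis using True by (simp add: nonpos_fps_def primitive_fps_def)
    next
      case False
      then show ?thesis
        using card_nonpos_words_rec[OF coprime pos, of g]
        by (simp add: nonpos_fps_def primitive_fps_def fps_mult_nth sum.atLeast_Suc_atMost)
    qed
  qed
  then show ?thesis by (simp add: algebra_simps)
qed

text \<open>This is \<open>card_words_rec\<close> divided by \<open>a + b\<close>, because all words
  of size \<open>g > 0\<close> number \<open>g * (a + b) * c a b g\<close>.\<close>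

lemma c_fps: "Abs_fps (\<lambda>i. real i * c a b i) = fps_X * fps_deriv (primitive_fps a b) * nonpos_fps a b"
proof (rule fps_ext)
  fix g
  show "fps_nth (Abs_fps (\<lambda>i. real i * c a b i)) g =
      fps_nth (fps_X * fps_deriv (primitive_fps a b) * nonpos_fps a b) g"
  proof (cases "g = 0")
    case False
    have "real (a + b) * fps_nth (fps_X * fps_deriv (primitive_fps a b) * nonpos_fps a b) g =
        (\<Sum>i\<le>g. real (i * (a + b) * (card (primitive_words a b i) * card (nonpos_words a b (g - i)))))"
      unfolding fps_mult_nth[of "fps_X * fps_deriv (primitive_fps a b)"] fps_euler_deriv_nth
        sum_distrib_left atLeast0AtMost
      by (intro sum.cong) (simp_all add: nonpos_fps_def primitive_fps_def)
    also have "\<dots> = real (card (words a b g))"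
      using card_words_rec[OF coprime pos, of g] False by simp
    also have "\<dots> = real (a + b) * (real g * c a b g)"
    proof -
      have "real (g * (a + b)) \<noteq> 0" using False pos by simp
      then have "real (card (words a b g)) = real (g * (a + b)) * c a b g"
        by (simp add: card_words[OF pos] c_def del: of_nat_mult of_nat_add)
      then show ?thesis by (simp add: mult_ac)
    qed
    finally show ?thesis using pos by simp
  qed simp
qed

text \<open>Differentiating \<open>Z * (1 - P) = 1\<close> and multiplying by \<open>Z\<close> gives
  \<open>Z' = P' * Z * Z\<close>. By \<open>c_fps\<close> this is the equation that characterizes
  the exponential of \<open>C\<close>.\<close>

lemma nonpos_fps_eq: "nonpos_fps a b = Abs_fps (part_sum (c a b))"
proof (rule fps_euler_deriv_unique)
  let ?Z = "nonpos_fps a b" and ?P = "primitive_fps a b"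
  have "fps_deriv (?Z * (1 - ?P)) = 0"
    by (simp add: nonpos_fps_mult_primitive)
  then have "fps_deriv ?Z * (1 - ?P) = fps_deriv ?P * ?Z"
    by (simp add: algebra_simps)
  then have "fps_deriv ?Z * (?Z * (1 - ?P)) = fps_deriv ?P * ?Z * ?Z"
    by (metis mult.assoc mult.commute)
  then have "fps_deriv ?Z = fps_deriv ?P * ?Z * ?Z"
    by (simp add: nonpos_fps_mult_primitive)
  then show "fps_X * fps_deriv ?Z = Abs_fps (\<lambda>i. real i * c a b i) * ?Z"
    by (simp add: c_fps mult.assoc)
  have "nonpos_words a b 0 = {[]}" by (auto simp: nonpos_words_def words_def)
  then show "fps_nth ?Z 0 = fps_nth (Abs_fps (part_sum (c a b))) 0"
    by (simp add: nonpos_fps_def part_sum_0)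
qed (simp_all add: fps_deriv_part_sum)

text \<open>Both sides are inverse to \<open>Z\<close>.\<close>

lemma primitive_fps_eq: "1 - primitive_fps a b = Abs_fps (part_sum (\<lambda>i. - c a b i))"
proof -
  have "1 - primitive_fps a b =
      (1 - primitive_fps a b) * (nonpos_fps a b * Abs_fps (part_sum (\<lambda>i. - c a b i)))"
    by (simp add: nonpos_fps_eq part_sum_uminus)
  also have "\<dots> = nonpos_fps a b * (1 - primitive_fps a b) * Abs_fps (part_sum (\<lambda>i. - c a b i))"
    by (simp only: mult_ac)
  finally show ?thesis by (simp add: nonpos_fps_mult_primitive)
qed

end

theorem theorem1p12:
  fixes a b g j :: nat
  assumes "a > 0" and "b > 0" and "coprime a b" and "g > 0" and "j < g"
  shows "real (mu a b j g) = (\<Sum>k=0..j. (-1) ^ k * E a b k * H a b (g - k))"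
proof -
  let ?Z = "nonpos_fps a b" and ?P = "primitive_fps a b"
  have E: "(-1) ^ k * E a b k = fps_nth (1 - ?P) k" for k
    using primitive_fps_eq[OF assms(1,3)] by (simp add: E_conv_part_sum)
  have H: "H a b k = fps_nth ?Z k" for k
    using nonpos_fps_eq[OF assms(1,3)] by (simp add: H_conv_part_sum)
  \<comment> \<open>For \<open>k = j * (a + b)\<close> the condition \<open>k < i * (a + b)\<close>
    reduces to \<open>j < i\<close>.\<close>
  have I: "{i. i \<le> g \<and> j < i} = {Suc j..g}"
    by auto
  have "j * (a + b) < g * (a + b)" using assms by simp
  then have "real (mu a b j g) =
      (\<Sum>i=Suc j..g. real (card (primitive_words a b i)) * real (card (nonpos_words a b (g - i))))"
    using card_words_positive_suffix_sums[of "j * (a + b)" g a b]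
      card_delayed_words[OF assms(3,1), of "j * (a + b)" g]
    by (simp add: mu_def card_paths_with_flaws assms I)
  \<comment> \<open>All indices are positive, so the coefficients of \<open>1 - ?P\<close> are the
    negated counts of primitive words.\<close>
  also have "\<dots> = - (\<Sum>i=Suc j..g. fps_nth (1 - ?P) i * fps_nth ?Z (g - i))"
    unfolding sum_negf[symmetric]
    by (intro sum.cong) (simp_all add: nonpos_fps_def primitive_fps_def)
  \<comment> \<open>As \<open>g > 0\<close>, the coefficient of \<open>(1 - ?P) * ?Z = 1\<close> at
    \<open>g\<close> is 0, so the tail of the Cauchy sum beyond \<open>j\<close> is the negative of
    its initial part.\<close>
  also have "\<dots> = (\<Sum>k=0..j. fps_nth (1 - ?P) k * fps_nth ?Z (g - k))"
  proof -
    have "(\<Sum>k=0..g. fps_nth (1 - ?P) k * fps_nth ?Z (g - k)) = fps_nth ((1 - ?P) * ?Z) g"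
      by (simp only: fps_mult_nth)
    also have "\<dots> = 0"
      using nonpos_fps_mult_primitive[OF assms(1,3)] assms(4) by (simp add: mult.commute)
    finally show ?thesis
      using sum.ub_add_nat[of 0 j "\<lambda>k. fps_nth (1 - ?P) k * fps_nth ?Z (g - k)" "g - j"] assms(5)
      by simp
  qed
  finally show ?thesis by (simp only: E H)
qed

end
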